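(* Let $I \supset [0,\infty)$ be an open interval and let $f : I \to (0,\infty)$ be differentiable. Let $a \in [0,\infty)$, $b \ge 1$, $a<b$, $q\ge 1$ and $m\in(0,1)$. Suppose that $f' \in L[a,b]$, that $|f'|^{q}$ is decreasing and $m$-geometrically convex on $[\min\{1,a\},b]$, and that $|f'(y)| \le M < 1$ for all $y \in [\min\{1,a\},b]$. Then for every $\mu>0$ and every $x \in [a,b]$, $$\left| \frac{(x-a)^{\mu}+(b-x)^{\mu}}{b-a} f(x) - \frac{\Gamma(\mu+1)}{b-a}\left[ J_{x^-}^{\mu} f(a) + J_{x^+}^{\mu} f(b) \right] \right| \le M^{m}\left(\frac{1}{\mu+1}\right)^{1-\frac1q}\left(\int_0^1 t^{\mu}M^{qt(1-m)}\,dt\right)^{\frac1q}\left[ \frac{(x-a)^{\mu+1}+(b-x)^{\mu+1}}{b-a} \right].$$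
   Context: Let $m\in(0,1]$. A positive function $g$ is $m$-geometrically convex on an interval $J\subset[0,\infty)$ if $g\left(x^{t}y^{m(1-t)}\right) \le [g(x)]^{t}[g(y)]^{m(1-t)}$ for all $x,y\in J$ and $t\in[0,1]$. $L[a,b]$ denotes the Lebesgue integrable functions on $[a,b]$, and $\Gamma$ is the Gamma function. The Riemann-Liouville fractional integrals of order $\mu>0$ are $J_{c^+}^{\mu} f(x)=\frac{1}{\Gamma(\mu)}\int_c^x (x-t)^{\mu-1}f(t)\,dt$ for $x>c$ and $J_{d^-}^{\mu} f(x)=\frac{1}{\Gamma(\mu)}\int_x^d (t-x)^{\mu-1}f(t)\,dt$ for $x<d$. Thus $J_{x^-}^{\mu} f(a)=\frac{1}{\Gamma(\mu)}\int_a^x (t-a)^{\mu-1}f(t)\,dt$ and $J_{x^+}^{\mu} f(b)=\frac{1}{\Gamma(\mu)}\int_x^b (b-t)^{\mu-1}f(t)\,dt$ (each being $0$ when the integration interval is a point). *)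

theory Defs
  imports "HOL-Analysis.Analysis"
begin

text \<open>
  Real powers of nonnegative bases with the usual convention \<open>0\<^sup>0 = 1\<close>; the library has
  \<open>0 powr 0 = 0\<close>. The two agree except at \<open>x = 0, t = 0\<close>.
\<close>

definition rpow :: "real \<Rightarrow> real \<Rightarrow> real" where
  "rpow x t = (if t = 0 then 1 else x powr t)"

text \<open>
  Intended for \<open>0 < m \<le> 1\<close> and an interval \<open>J \<subseteq> {0..}\<close>. An endpoint \<open>0\<close> is allowed in \<open>J\<close>, so the
  argument of \<open>g\<close> is formed with \<open>rpow\<close>: otherwise the instances \<open>x = 0, t = 0\<close> and \<open>y = 0, t = 1\<close>
  would be wrong. The values of \<open>g\<close> are positive, so \<open>powr\<close> is adequate on the right-hand side.
\<close>

definition m_geometrically_convex_on :: "real \<Rightarrow> real set \<Rightarrow> (real \<Rightarrow> real) \<Rightarrow> bool" where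
  "m_geometrically_convex_on m J g \<longleftrightarrow>
     (\<forall>x\<in>J. 0 < g x) \<and>
     (\<forall>x\<in>J. \<forall>y\<in>J. \<forall>t\<in>{0..1}.
        g (rpow x t * rpow y (m * (1 - t))) \<le> g x powr t * g y powr (m * (1 - t)))"

text \<open>
  Riemann--Liouville fractional integrals of order \<open>\<mu>\<close>: \<open>RL_plus \<mu> c f x\<close> is the integral with base
  point \<open>c\<close> evaluated at \<open>x \<ge> c\<close>, and \<open>RL_minus \<mu> d f x\<close> the one with base point \<open>d\<close> evaluated at
  \<open>x \<le> d\<close>. Both vanish when \<open>x\<close> is the base point.
\<close>

definition RL_plus :: "real \<Rightarrow> real \<Rightarrow> (real \<Rightarrow> real) \<Rightarrow> real \<Rightarrow> real" where
  "RL_plus \<mu> c f x = 1 / Gamma \<mu> * (LINT t:{c..x}|lebesgue. (x - t) powr (\<mu> - 1) * f t)"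

definition RL_minus :: "real \<Rightarrow> real \<Rightarrow> (real \<Rightarrow> real) \<Rightarrow> real \<Rightarrow> real" where
  "RL_minus \<mu> d f x = 1 / Gamma \<mu> * (LINT t:{x..d}|lebesgue. (t - x) powr (\<mu> - 1) * f t)"

end

theory Submission
  imports Defs
begin

text \<open>
  Since \<open>M < 1\<close>, the right-hand side is at least \<open>M / (\<mu> + 1)\<close> times the last bracket: bound
  \<open>M powr (q * t * (1 - m))\<close> from below by its value at \<open>t = 1\<close>. It therefore suffices that
  \<open>f\<close> has Lipschitz constant \<open>M\<close>. As \<open>(x - a) powr \<mu>\<close> is the integral of
  \<open>\<mu> * (t - a) powr (\<mu> - 1)\<close> over \<open>{a..x}\<close>, the left half of the difference is
  a weighted integral of \<open>f x - f t\<close>, which is at most \<open>M * (x - t)\<close> in absolute value;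
  the right half is treated in the same way.
\<close>

text \<open>For \<open>p < 1\<close> the integrand is unbounded near \<open>c\<close>. The
  antiderivative is still continuous on all of \<open>{c..d}\<close>, so the fundamental theorem
  with derivatives only at interior points applies.\<close>

lemma has_integral_powr_left:
  fixes c d p :: real
  assumes "c \<le> d" "0 < p"
  shows "((\<lambda>t. (t - c) powr (p - 1)) has_integral (d - c) powr p / p) {c..d}"
proof -
  have "((\<lambda>t. (t - c) powr (p - 1)) has_integral (d - c) powr p / p - (c - c) powr p / p) {c..d}"
  proof (rule fundamental_theorem_of_calculus_interior)
    show "continuous_on {c..d} (\<lambda>t. (t - c) powr p / p)"
      using assms by (intro continuous_intros continuous_on_powr') auto
    show "((\<lambda>t. (t - c) powr p / p) has_vector_derivative (t - c) powr (p - 1)) (at t)"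
      if "t \<in> {c<..<d}" for t
      using that assms unfolding has_real_derivative_iff_has_vector_derivative[symmetric]
      by (auto intro!: derivative_eq_intros)
  qed (use assms in auto)
  then show ?thesis using assms by simp
qed

lemma has_integral_powr_right:
  fixes c d p :: real
  assumes "c \<le> d" "0 < p"
  shows "((\<lambda>t. (d - t) powr (p - 1)) has_integral (d - c) powr p / p) {c..d}"
  using has_integral_powr_left[of "-d" "-c" p] assms
  by (subst has_integral_reflect_real[symmetric]) (simp add: add.commute)

text \<open>On \<open>{c..d}\<close> write \<open>d - t\<close> as \<open>(d - c) - (t - c)\<close>,
  which leaves two pure powers. The constant is \<open>1 / \<mu> - 1 / (\<mu> + 1)\<close>.\<close>

lemma has_integral_powr_mult_left:
  fixes c d \<mu> :: real
  assumes "c \<le> d" "0 < \<mu>"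
  shows "((\<lambda>t. (t - c) powr (\<mu> - 1) * \<bar>d - t\<bar>) has_integral
           (d - c) powr (\<mu> + 1) / (\<mu> * (\<mu> + 1))) {c..d}"
proof -
  have "((\<lambda>t. (d - c) * (t - c) powr (\<mu> - 1) - (t - c) powr (\<mu> + 1 - 1)) has_integral
          (d - c) * ((d - c) powr \<mu> / \<mu>) - (d - c) powr (\<mu> + 1) / (\<mu> + 1)) {c..d}"
    using assms by (intro has_integral_diff has_integral_mult_right has_integral_powr_left) auto
  moreover have "(d - c) * (t - c) powr (\<mu> - 1) - (t - c) powr (\<mu> + 1 - 1)
      = (t - c) powr (\<mu> - 1) * \<bar>d - t\<bar>" if "t \<in> {c..d}" for t
    using that powr_mult_base[of "t - c" "\<mu> - 1"] by (simp add: algebra_simps)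
  moreover have "(d - c) * ((d - c) powr \<mu> / \<mu>) - (d - c) powr (\<mu> + 1) / (\<mu> + 1)
      = (d - c) powr (\<mu> + 1) / (\<mu> * (\<mu> + 1))"
    using assms powr_mult_base[of "d - c" \<mu>] by (simp add: field_simps)
  ultimately show ?thesis
    by (metis (no_types, lifting) has_integral_cong)
qed

lemma has_integral_powr_mult_right:
  fixes c d \<mu> :: real
  assumes "c \<le> d" "0 < \<mu>"
  shows "((\<lambda>t. (d - t) powr (\<mu> - 1) * \<bar>c - t\<bar>) has_integral
           (d - c) powr (\<mu> + 1) / (\<mu> * (\<mu> + 1))) {c..d}"
  using has_integral_powr_mult_left[of "-d" "-c" \<mu>] assms
  by (subst has_integral_reflect_real[symmetric]) (simp add: add.commute abs_minus_commute)

text \<open>Since \<open>A * f x\<close> is the integral of \<open>w t * f x\<close>, the difference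
  is the integral of \<open>w t * (f x - f t)\<close>, to which the Lipschitz bound applies
  pointwise.\<close>

lemma weighted_integral_deviation:
  fixes w f :: "real \<Rightarrow> real"
  assumes w: "(w has_integral A) {c..d}"
    and v: "((\<lambda>t. w t * \<bar>x - t\<bar>) has_integral B) {c..d}"
    and nonneg: "\<And>t. t \<in> {c..d} \<Longrightarrow> 0 \<le> w t"
    and cont: "continuous_on {c..d} f"
    and lip: "\<And>t. t \<in> {c..d} \<Longrightarrow> \<bar>f x - f t\<bar> \<le> M * \<bar>x - t\<bar>"
  shows "\<bar>A * f x - (LINT t:{c..d}|lebesgue. w t * f t)\<bar> \<le> M * B"
proof -
  have "w absolutely_integrable_on {c..d}"
    using w nonneg by (intro nonnegative_absolutely_integrable_1) auto
  moreover have "f \<in> borel_measurable (lebesgue_on {c..d})"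
    using cont by (intro continuous_imp_measurable_on_sets_lebesgue) auto
  moreover have "bounded (f ` {c..d})"
    using cont by (intro compact_imp_bounded compact_continuous_image) auto
  ultimately have "(\<lambda>t. f t * w t) absolutely_integrable_on {c..d}"
    by (intro absolutely_integrable_bounded_measurable_product_real) auto
  then have wf: "(\<lambda>t. w t * f t) absolutely_integrable_on {c..d}"
    by (simp add: mult.commute)
  then have "((\<lambda>t. w t * f t) has_integral (LINT t:{c..d}|lebesgue. w t * f t)) {c..d}"
    by (rule has_integral_set_lebesgue)
  with w have diff: "((\<lambda>t. w t * f x - w t * f t) has_integral
      (A * f x - (LINT t:{c..d}|lebesgue. w t * f t))) {c..d}"
    by (intro has_integral_diff has_integral_mult_left)
  have Mv: "((\<lambda>t. M * (w t * \<bar>x - t\<bar>)) has_integral M * B) {c..d}"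
    using v by (rule has_integral_mult_right)
  have "norm (integral {c..d} (\<lambda>t. w t * f x - w t * f t))
      \<le> integral {c..d} (\<lambda>t. M * (w t * \<bar>x - t\<bar>))"
  proof (rule integral_norm_bound_integral)
    fix t assume t: "t \<in> {c..d}"
    have "norm (w t * f x - w t * f t) = w t * \<bar>f x - f t\<bar>"
      using nonneg[OF t] by (simp add: abs_mult flip: right_diff_distrib)
    also have "\<dots> \<le> w t * (M * \<bar>x - t\<bar>)"
      using nonneg[OF t] lip[OF t] by (rule mult_left_mono[rotated])
    finally show "norm (w t * f x - w t * f t) \<le> M * (w t * \<bar>x - t\<bar>)"
      by (simp add: mult_ac)
  qed (use diff Mv in \<open>auto simp: has_integral_iff\<close>)
  then show ?thesis
    by (simp only: integral_unique[OF diff] integral_unique[OF Mv] real_norm_def)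
qed

text \<open>As \<open>M < 1\<close> and \<open>r * t \<le> r\<close> on the unit interval, the
  second factor is at least \<open>M powr r\<close>, and \<open>t powr \<mu>\<close> integrates to
  \<open>1 / (\<mu> + 1)\<close>.\<close>

lemma integral_powr_mult_exp_ge:
  fixes M \<mu> r :: real
  assumes "0 < M" "M < 1" "0 < \<mu>" "0 \<le> r"
  shows "M powr r / (\<mu> + 1) \<le> (LINT t:{0..1}|lebesgue. t powr \<mu> * M powr (r * t))"
proof -
  have cont: "continuous_on {0..1} (\<lambda>t::real. t powr \<mu> * M powr (r * t))"
    using assms by (intro continuous_intros continuous_on_powr') auto
  have int: "((\<lambda>t. t powr \<mu> * M powr (r * t)) has_integral
      (LINT t:{0..1}|lebesgue. t powr \<mu> * M powr (r * t))) {0..1}"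
    using absolutely_integrable_continuous_real[OF cont] by (rule has_integral_set_lebesgue)
  have lower: "((\<lambda>t. t powr \<mu> * M powr r) has_integral 1 / (\<mu> + 1) * M powr r) {0..1}"
    using has_integral_powr_left[of 0 1 "\<mu> + 1"] assms by (intro has_integral_mult_left) simp
  have "t powr \<mu> * M powr r \<le> t powr \<mu> * M powr (r * t)" if "t \<in> {0..1}" for t
  proof -
    have "r * t \<le> r"
      using that assms by (simp add: mult_left_le)
    then show ?thesis
      using assms by (intro mult_left_mono powr_mono') auto
  qed
  then show ?thesis
    using has_integral_le[OF lower int] by simp
qed

theorem corollary3:
  fixes I :: "real set" and f :: "real \<Rightarrow> real" and a b q m M \<mu> x :: real
  assumes "open I" and "is_interval I" and "{0..} \<subseteq> I"
    and "\<forall>y\<in>I. 0 < f y"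
    and "f differentiable_on I"
    and "0 \<le> a" and "1 \<le> b" and "a < b"
    and "1 \<le> q"
    and "0 < m" and "m < 1"
    and "set_integrable lebesgue {a..b} (deriv f)"
    and "antimono_on {min 1 a..b} (\<lambda>y. \<bar>deriv f y\<bar> powr q)"
    and "m_geometrically_convex_on m {min 1 a..b} (\<lambda>y. \<bar>deriv f y\<bar> powr q)"
    and "\<forall>y\<in>{min 1 a..b}. \<bar>deriv f y\<bar> \<le> M" and "M < 1"
    and "0 < \<mu>"
    and "x \<in> {a..b}"
  shows "\<bar>((x - a) powr \<mu> + (b - x) powr \<mu>) / (b - a) * f x
            - Gamma (\<mu> + 1) / (b - a) * (RL_minus \<mu> x f a + RL_plus \<mu> x f b)\<bar>
         \<le> M powr m * (1 / (\<mu> + 1)) powr (1 - 1 / q)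
            * (LINT t:{0..1}|lebesgue. t powr \<mu> * M powr (q * t * (1 - m))) powr (1 / q)
            * (((x - a) powr (\<mu> + 1) + (b - x) powr (\<mu> + 1)) / (b - a))"
proof -
  define J where "J = (LINT t:{0..1}|lebesgue. t powr \<mu> * M powr (q * t * (1 - m)))"
  \<comment> \<open>The point \<open>1\<close> lies in the interval because
    \<open>1 \<le> b\<close>. Geometric convexity includes positivity, so \<open>deriv f 1\<close>
    is nonzero and hence \<open>M > 0\<close>.\<close>
  have one: "1 \<in> {min 1 a..b}"
    using assms by auto
  then have "0 < \<bar>deriv f 1\<bar> powr q"
    using assms(14) unfolding m_geometrically_convex_on_def by blast
  moreover have "\<bar>deriv f 1\<bar> \<le> M"
    using assms(15) one by blast
  ultimately have M: "0 < M"
    by (cases "deriv f 1 = 0") auto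
  have I: "{a..b} \<subseteq> I"
    using assms(3,6) by auto
  have deriv: "(f has_field_derivative deriv f y) (at y)" if "y \<in> {a..b}" for y
    using that I assms(1,5)
    by (auto simp: DERIV_deriv_iff_real_differentiable differentiable_on_eq_differentiable_at)
  have cont: "continuous_on {a..b} f"
    using I assms(5) by (meson continuous_on_subset differentiable_imp_continuous_on)
  have lip: "\<bar>f x - f t\<bar> \<le> M * \<bar>x - t\<bar>" if "t \<in> {a..b}" for t
  proof -
    \<comment> \<open>Mean value inequality on the convex set \<open>{a..b}\<close>, which lies
      inside \<open>{min 1 a..b}\<close>, where the derivative is bounded by
      \<open>M\<close>.\<close>
    have "norm (f x - f t) \<le> M * norm (x - t)"
    proof (rule field_differentiable_bound[of "{a..b}"])
      show "(f has_field_derivative deriv f z) (at z within {a..b})" if "z \<in> {a..b}" for z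
        using deriv[OF that] by (rule has_field_derivative_at_within)
    qed (use that assms(15,18) in auto)
    then show ?thesis
      by simp
  qed
  have \<mu>: "Gamma (\<mu> + 1) = \<mu> * Gamma \<mu>" "Gamma \<mu> > 0"
    using assms(17) by (auto intro!: Gamma_plus1 Gamma_real_pos elim: nonpos_Ints_cases)
  define L where "L = (LINT t:{a..x}|lebesgue. (t - a) powr (\<mu> - 1) * f t)"
  define R where "R = (LINT t:{x..b}|lebesgue. (b - t) powr (\<mu> - 1) * f t)"
  \<comment> \<open>Here \<open>x\<close> is the endpoint opposite to the base of the weight
    \<open>(t - a) powr (\<mu> - 1)\<close>; for \<open>right\<close> the roles of the endpoints are
    exchanged.\<close>
  have left: "\<bar>(x - a) powr \<mu> / \<mu> * f x - L\<bar>
      \<le> M * ((x - a) powr (\<mu> + 1) / (\<mu> * (\<mu> + 1)))"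
    unfolding L_def using assms(17,18)
    by (intro weighted_integral_deviation has_integral_powr_left has_integral_powr_mult_left
        continuous_on_subset[OF cont] lip) auto
  have right: "\<bar>(b - x) powr \<mu> / \<mu> * f x - R\<bar>
      \<le> M * ((b - x) powr (\<mu> + 1) / (\<mu> * (\<mu> + 1)))"
    unfolding R_def using assms(17,18)
    by (intro weighted_integral_deviation has_integral_powr_right has_integral_powr_mult_right
        continuous_on_subset[OF cont] lip) auto
  define S where "S = ((x - a) powr (\<mu> + 1) + (b - x) powr (\<mu> + 1)) / (b - a)"
  \<comment> \<open>Stated for abstract \<open>P\<close>, \<open>Q\<close>, \<open>D\<close>,
    \<open>F\<close>, \<open>G\<close> so that simplification treats the powers as atoms. With
    \<open>G = Gamma \<mu>\<close>, the Gamma factors cancel up to \<open>\<mu>\<close>.\<close>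
  have split: "(P + Q) / D * F - \<mu> * G / D * (1 / G * L + 1 / G * R)
      = \<mu> / D * ((P / \<mu> * F - L) + (Q / \<mu> * F - R))"
    if "G \<noteq> 0" "D \<noteq> 0" for P Q D F G :: real
    using that assms(17) by (simp add: field_simps)
  have "((x - a) powr \<mu> + (b - x) powr \<mu>) / (b - a) * f x
      - Gamma (\<mu> + 1) / (b - a) * (RL_minus \<mu> x f a + RL_plus \<mu> x f b)
      = \<mu> / (b - a) * (((x - a) powr \<mu> / \<mu> * f x - L) + ((b - x) powr \<mu> / \<mu> * f x - R))"
    unfolding RL_minus_def RL_plus_def L_def[symmetric] R_def[symmetric] \<mu>(1)
    using \<mu>(2) assms(8) by (intro split) auto
  also have "\<bar>\<dots>\<bar> \<le> \<mu> / (b - a) * (M * ((x - a) powr (\<mu> + 1) / (\<mu> * (\<mu> + 1)))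
      + M * ((b - x) powr (\<mu> + 1) / (\<mu> * (\<mu> + 1))))"
    unfolding abs_mult using assms(8,17)
    by (intro mult_mono order_trans[OF abs_triangle_ineq] add_mono left right) auto
  also have "\<dots> = M / (\<mu> + 1) * S"
    unfolding S_def using assms(8,17) by (simp add: divide_simps) (simp add: algebra_simps)
  also have "\<dots> \<le> M powr m * (1 / (\<mu> + 1)) powr (1 - 1 / q) * J powr (1 / q) * S"
  proof (rule mult_right_mono)
    \<comment> \<open>Both exponents \<open>1\<close> are split so that the factors of the target
      other than \<open>J powr (1 / q)\<close> come out. What remains is the \<open>1 / q\<close>-th
      power of the lower bound for \<open>J\<close> with \<open>r = q * (1 - m)\<close>.\<close>
    have "M / (\<mu> + 1) = M powr (m + (1 - m)) * (1 / (\<mu> + 1)) powr ((1 - 1 / q) + 1 / q)"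
      using M assms(17) by simp
    also have "\<dots> = M powr m * (1 / (\<mu> + 1)) powr (1 - 1 / q)
        * (M powr (1 - m) * (1 / (\<mu> + 1)) powr (1 / q))"
      unfolding powr_add by (simp only: mult_ac)
    also have "M powr (1 - m) * (1 / (\<mu> + 1)) powr (1 / q)
        = (M powr (q * (1 - m)) / (\<mu> + 1)) powr (1 / q)"
      using assms(9,17) by (simp add: powr_divide powr_powr)
    also have "\<dots> \<le> J powr (1 / q)"
      using integral_powr_mult_exp_ge[of M \<mu> "q * (1 - m)"] M assms(9,11,16,17)
      unfolding J_def by (intro powr_mono2) (auto simp: mult_ac)
    finally show "M / (\<mu> + 1) \<le> M powr m * (1 / (\<mu> + 1)) powr (1 - 1 / q) * J powr (1 / q)"
      by (simp add: mult_left_mono)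
    show "0 \<le> S"
      unfolding S_def using assms(8) by simp
  qed
  finally show ?thesis
    unfolding J_def S_def .
qed

end
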